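(* For any $\tau,n\in\mathbb Z_{\ge1}$, every fair allocation policy $\pi_{\mathsf{FA}}$ satisfies $$\inf_{L\in\mathbb Z_{\ge1}^n,\ C\in\mathbb Z_{\ge1}}\frac{V^{\pi_{\mathsf{FA}}}_{\mathsf{EAM}_\tau}(L)}{\min\{C\tau,\sum_{i=1}^nL_i\}}\ge n^{-1/\tau}.$$ In particular, when $\tau=1$, $V^{\pi_{\mathsf{FA}}}_{\mathsf{EAM}_1}/V^*_{\mathsf{EAM}_1}\ge1/n$ for every $C\in\mathbb Z_{\ge1}$ and $q\in[0,1)^n$. Moreover, for any fixed $\tau,n\in\mathbb Z_{\ge1}$ with $n^{1/\tau}\in\mathbb Z_{\ge1}$, these bounds are asymptotically tight as $C/n\to\infty$ through integers: as $C\to\infty$ along multiples of $n$, $$\inf_{L\in\mathbb Z_{\ge1}^n}\frac{V^{\pi_{\mathsf{FA}}}_{\mathsf{EAM}_\tau}(L)}{\min\{C\tau,\sum_{i=1}^nL_i\}}\to n^{-1/\tau},$$ and, for $\tau=1$, $\inf_{q\in[0,1)^n}V^{\pi_{\mathsf{FA}}}_{\mathsf{EAM}_1}/V^*_{\mathsf{EAM}_1}\to1/n$.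
   Context: Model. An instance has $n\ge1$ threats $[n]=\{1,\dots,n\}$, a per-round capacity $C\in\mathbb Z_{\ge1}$ of effectors, and difficulties $q=(q_i)\in[0,1)^n$, where $q_i$ is the probability that a single effector fails to neutralize threat $i$. Demands $L_1,\dots,L_n$ are independent, $L_i\sim\mathrm{Geom}(1-q_i)$ on $\{1,2,\dots\}$, i.e. $\Pr(L_i>k)=q_i^k$ (with $0^0=1$). $\mathcal M_t\subseteq[n]$ is the set of active threats at the start of round $t$, $\mathcal M_1=[n]$. A policy is $\pi=(\pi_t)_{t\ge1}$, where $\pi_t$ maps each subset $\mathcal M\subseteq[n]$ to a vector $\pi_t(\mathcal M)\in\mathbb Z_{\ge0}^n$ with $\sum_{i\in[n]}[\pi_t(\mathcal M)]_i\le C$ and, for every nonempty $\mathcal M$ and every $t$, $\sum_{i\in\mathcal M}[\pi_t(\mathcal M)]_i=C$; $\Pi$ is the set of all such policies. Under $\pi$, the round-$t$ allocation is $x^t=\pi_t(\mathcal M_t)$ and $\mathcal M_{t+1}=\{i\in\mathcal M_t:\sum_{\ell=1}^t x_i^\ell<L_i\}$. Objective. For a fixed realization $L\in\mathbb Z_{\ge1}^n$ of the demands, $V^\pi_{\mathsf{EAM}_\tau}(L)=\sum_{i=1}^n\min\{\sum_{t=1}^\tau x_i^t,L_i\}$ is the number of effective assignments in $\tau$ rounds. $V^\pi_{\mathsf{EAM}_\tau}=\mathbb E[V^\pi_{\mathsf{EAM}_\tau}(L)]$ over the geometric demands, and $V^*_{\mathsf{EAM}_\tau}=\max_{\pi\in\Pi}V^\pi_{\mathsf{EAM}_\tau}$.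 Fair allocation. For nonempty $\mathcal M\subseteq[n]$, $x\in\mathbb Z_{\ge0}^n$ is fair for $\mathcal M$ if $\sum_{i\in\mathcal M}x_i=C$, $x_i=0$ for $i\notin\mathcal M$, and $|x_i-x_j|\in\{0,1\}$ for all $i,j\in\mathcal M$. A fair allocation policy is a $\pi\in\Pi$ such that $\pi_t(\mathcal M)$ is fair for $\mathcal M$ for every nonempty $\mathcal M\subseteq[n]$ and every $t\ge1$ (one such policy for each capacity $C$). *)

theory Defs
  imports "HOL-Probability.Probability" "HOL-Probability.Product_PMF"
begin

text \<open>
  Threats are the elements of \<open>{1..n}\<close>.  An allocation is a function \<open>nat \<Rightarrow> nat\<close> of which only the
  values on \<open>{1..n}\<close> matter, and \<open>\<pi> t M i\<close> is the number of effectors that the policy \<open>\<pi>\<close> assigns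
  to threat \<open>i\<close> in round \<open>t\<close> when \<open>M\<close> is the set of active threats.  Only rounds \<open>t \<ge> 1\<close> and sets
  \<open>M \<subseteq> {1..n}\<close> are meaningful.
\<close>

type_synonym policy = "nat \<Rightarrow> nat set \<Rightarrow> nat \<Rightarrow> nat"

definition policies :: "nat \<Rightarrow> nat \<Rightarrow> policy set" where
  "policies n C = {\<pi>. \<forall>t\<ge>1. \<forall>M\<subseteq>{1..n}.
     (\<Sum>i\<in>{1..n}. \<pi> t M i) \<le> C \<and> (M \<noteq> {} \<longrightarrow> (\<Sum>i\<in>M. \<pi> t M i) = C)}"

definition fair :: "nat \<Rightarrow> nat \<Rightarrow> nat set \<Rightarrow> (nat \<Rightarrow> nat) \<Rightarrow> bool" where
  "fair n C M x \<longleftrightarrow>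
     (\<Sum>i\<in>M. x i) = C \<and> (\<forall>i\<in>{1..n} - M. x i = 0) \<and>
     (\<forall>i\<in>M. \<forall>j\<in>M. \<bar>int (x i) - int (x j)\<bar> \<in> {0, 1})"

definition fair_policies :: "nat \<Rightarrow> nat \<Rightarrow> policy set" where
  "fair_policies n C =
     {\<pi> \<in> policies n C. \<forall>t\<ge>1. \<forall>M\<subseteq>{1..n}. M \<noteq> {} \<longrightarrow> fair n C M (\<pi> t M)}"

definition demands :: "nat \<Rightarrow> (nat \<Rightarrow> nat) set" where
  "demands n = {1..n} \<rightarrow>\<^sub>E {1..}"

definition difficulties :: "nat \<Rightarrow> (nat \<Rightarrow> real) set" where
  "difficulties n = {1..n} \<rightarrow>\<^sub>E {0..<1}"

text \<open>Rounds are numbered from 1; the value at 0 is a dummy.\<close>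

fun active :: "nat \<Rightarrow> policy \<Rightarrow> (nat \<Rightarrow> nat) \<Rightarrow> nat \<Rightarrow> nat set" where
  "active n \<pi> L 0 = {1..n}"
| "active n \<pi> L (Suc 0) = {1..n}"
| "active n \<pi> L (Suc (Suc t)) =
     {i \<in> active n \<pi> L (Suc t). (\<Sum>l\<in>{1..Suc t}. \<pi> l (active n \<pi> L l) i) < L i}"

definition alloc :: "nat \<Rightarrow> policy \<Rightarrow> (nat \<Rightarrow> nat) \<Rightarrow> nat \<Rightarrow> nat \<Rightarrow> nat" where
  "alloc n \<pi> L t = \<pi> t (active n \<pi> L t)"

definition eam_at :: "nat \<Rightarrow> nat \<Rightarrow> policy \<Rightarrow> (nat \<Rightarrow> nat) \<Rightarrow> nat" where
  "eam_at n \<tau> \<pi> L = (\<Sum>i\<in>{1..n}. min (\<Sum>t\<in>{1..\<tau>}. alloc n \<pi> L t i) (L i))"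

text \<open>
  The library's \<open>geometric_pmf p\<close> lives on \<open>{0, 1, \<dots>}\<close> and counts failures before the first success,
  hence the shift by \<open>Suc\<close>.  \<open>Pi_pmf\<close> is the law of independent components; the value
  \<open>undefined\<close> outside \<open>{1..n}\<close> matches the extensional functions of \<open>demands n\<close>.
\<close>

definition demand_pmf :: "nat \<Rightarrow> (nat \<Rightarrow> real) \<Rightarrow> (nat \<Rightarrow> nat) pmf" where
  "demand_pmf n q = Pi_pmf {1..n} undefined (\<lambda>i. map_pmf Suc (geometric_pmf (1 - q i)))"

definition eam :: "nat \<Rightarrow> nat \<Rightarrow> (nat \<Rightarrow> real) \<Rightarrow> policy \<Rightarrow> real" where
  "eam n \<tau> q \<pi> = measure_pmf.expectation (demand_pmf n q) (\<lambda>L. real (eam_at n \<tau> \<pi> L))"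

definition eam_opt :: "nat \<Rightarrow> nat \<Rightarrow> nat \<Rightarrow> (nat \<Rightarrow> real) \<Rightarrow> real" where
  "eam_opt n C \<tau> q = Max (eam n \<tau> q ` policies n C)"

lemma demand_tail:
  assumes "0 \<le> r" "r < 1"
  shows "measure_pmf.prob (map_pmf Suc (geometric_pmf (1 - r))) {k<..} = r ^ k"
proof -
  let ?G = "geometric_pmf (1 - r)"
  have vim: "Suc -` {k<..} = UNIV - {..<k}"
    by auto
  have "measure_pmf.prob ?G {..<k} = (\<Sum>j<k. r ^ j * (1 - r))"
    using assms by (simp add: measure_measure_pmf_finite)
  also have "\<dots> = 1 - r ^ k"
    by (simp add: one_diff_power_eq sum_distrib_right mult.commute flip: sum_distrib_left)
  finally show ?thesis
    using measure_pmf.prob_compl[of "{..<k}" ?G] by (simp add: measure_map_pmf vim)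
qed

lemma active_subset: "active n \<pi> L t \<subseteq> {1..n}"
  by (induction n \<pi> L t rule: active.induct) auto

lemma active_cong:
  assumes "\<And>t M i. t \<in> {1..\<tau>} \<Longrightarrow> M \<subseteq> {1..n} \<Longrightarrow> i \<in> {1..n} \<Longrightarrow> \<pi> t M i = \<pi>' t M i"
  shows "t \<le> \<tau> \<Longrightarrow> active n \<pi> L t = active n \<pi>' L t"
proof (induction t rule: less_induct)
  case (less t)
  consider "t = 0" | "t = Suc 0" | s where "t = Suc (Suc s)"
    by (metis not0_implies_Suc)
  then show ?case
  proof cases
    case 3
    have IH: "active n \<pi> L l = active n \<pi>' L l" if "l \<le> Suc s" for l
      using less 3 that by auto
    have "(\<Sum>l\<in>{1..Suc s}. \<pi> l (active n \<pi> L l) i) = (\<Sum>l\<in>{1..Suc s}. \<pi>' l (active n \<pi>' L l) i)"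
      if "i \<in> {1..n}" for i
    proof (rule sum.cong)
      fix l assume "l \<in> {1..Suc s}"
      then show "\<pi> l (active n \<pi> L l) i = \<pi>' l (active n \<pi>' L l) i"
        using assms[of l "active n \<pi>' L l" i] IH[of l] active_subset[of n \<pi>' L l] that less.prems 3
        by auto
    qed simp
    then show ?thesis
      using 3 IH[of "Suc s"] active_subset[of n \<pi>' L "Suc s"] by auto
  qed auto
qed

lemma eam_at_cong:
  assumes "\<And>t M i. t \<in> {1..\<tau>} \<Longrightarrow> M \<subseteq> {1..n} \<Longrightarrow> i \<in> {1..n} \<Longrightarrow> \<pi> t M i = \<pi>' t M i"
  shows "eam_at n \<tau> \<pi> L = eam_at n \<tau> \<pi>' L"
proof -
  have "alloc n \<pi> L t i = alloc n \<pi>' L t i" if "i \<in> {1..n}" "t \<in> {1..\<tau>}" for i t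
    using assms[of t "active n \<pi>' L t" i] active_cong[of \<tau> n \<pi> \<pi>' t L, OF assms]
      active_subset[of n \<pi>' L t] that
    by (auto simp: alloc_def)
  then show ?thesis
    unfolding eam_at_def by (intro sum.cong arg_cong2[of _ _ _ _ min]) auto
qed

text \<open>There are infinitely many policies, but \<open>Max\<close> in \<open>eam_opt\<close> ranges over a finite set.\<close>

lemma finite_eam_policies: "finite (eam n \<tau> q ` policies n C)"
proof -
  define r :: "policy \<Rightarrow> policy" where
    "r \<pi> = (\<lambda>t\<in>{1..\<tau>}. \<lambda>M\<in>Pow {1..n}. \<lambda>i\<in>{1..n}. \<pi> t M i)" for \<pi>
  define F :: "policy set" where
    "F = ({1..\<tau>} \<rightarrow>\<^sub>E (Pow {1..n} \<rightarrow>\<^sub>E ({1..n} \<rightarrow>\<^sub>E {..C})))"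
  have "eam_at n \<tau> \<pi> L = eam_at n \<tau> (r \<pi>) L" for \<pi> L
    by (rule eam_at_cong) (auto simp: r_def)
  then have eq: "eam n \<tau> q \<pi> = eam n \<tau> q (r \<pi>)" for \<pi>
    by (simp add: eam_def)
  have mem: "r \<pi> \<in> F" if "\<pi> \<in> policies n C" for \<pi>
  proof -
    have "\<pi> t M i \<le> C" if "t \<in> {1..\<tau>}" "M \<subseteq> {1..n}" "i \<in> {1..n}" for t M i
    proof -
      have "\<pi> t M i \<le> (\<Sum>i\<in>{1..n}. \<pi> t M i)"
        using that by (intro member_le_sum) auto
      also have "\<dots> \<le> C"
        using \<open>\<pi> \<in> policies n C\<close> that by (auto simp: policies_def)
      finally show ?thesis .
    qed
    then show ?thesis
      by (auto simp: r_def F_def)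
  qed
  have "eam n \<tau> q ` policies n C \<subseteq> eam n \<tau> q ` F"
    using eq mem by blast
  moreover have "finite F"
    unfolding F_def by (intro finite_PiE) auto
  ultimately show ?thesis
    by (meson finite_imageI finite_subset)
qed

end

theory Submission
  imports Defs
begin

text \<open>
  Let \<open>m t\<close> be the number of active threats at the start of round \<open>t\<close>.  A fair round makes at least
  \<open>C * m (t + 1) / m t\<close> effective assignments, and by AM-GM the telescoping ratios sum to at least
  \<open>\<tau> * n powr (- 1 / \<tau>)\<close> as long as some threat survives; otherwise all demands are met.
  For one round this pointwise bound integrates.  The bound is attained asymptotically when
  \<open>n = b ^ \<tau>\<close>, all ratios equal \<open>1 / b\<close> and dying threats need a single effector in their last round;
  in the stochastic one-round case, when one threat is almost impossible and all others are trivial.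
\<close>

section \<open>Fair allocations and active sets\<close>

text \<open>If one active threat received more than \<open>K\<close>, fairness would give every
  other active threat at least \<open>K\<close>, so the total would exceed
  \<open>K * card M\<close>.\<close>

lemma fair_le_ceiling:
  assumes "fair n C M x" "finite M" "i \<in> M" "C \<le> K * card M"
  shows "x i \<le> K"
proof (rule ccontr)
  assume "\<not> x i \<le> K"
  then have gt: "K < x i"
    by simp
  have "K \<le> x j" if "j \<in> M" for j
    using assms(1,3) that gt unfolding fair_def by fastforce
  then have "(\<Sum>j\<in>M. K) < (\<Sum>j\<in>M. x j)"
    using assms(2,3) gt by (intro sum_strict_mono_ex1) auto
  then show False
    using assms(1,4) by (simp add: fair_def mult.commute)
qed

text \<open>Sum \<open>x i \<le> x j + 1\<close> over all \<open>j\<close> in \<open>M\<close>. This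
  bounds the waste \<open>x i - 1\<close> of a dying threat by \<open>C / card M\<close> while
  staying in the naturals.\<close>

lemma card_mult_fair_le:
  assumes "fair n C M x" "finite M" "i \<in> M"
  shows "card M * x i \<le> C + card M"
proof -
  have "x i \<le> x j + 1" if "j \<in> M" for j
    using assms(1,3) that unfolding fair_def by fastforce
  then have "(\<Sum>j\<in>M. x i) \<le> (\<Sum>j\<in>M. x j + 1)"
    by (intro sum_mono) auto
  also have "\<dots> = C + card M"
    using assms(1) unfolding fair_def sum.distrib by simp
  finally show ?thesis
    by simp
qed

text \<open>Cumulative allocations never decrease, so the latest filter in the recursion subsumes
  all earlier ones. In round 1 the sum is empty, and \<open>1 \<le> L i\<close> makes every threat
  active.\<close>

lemma active_Suc_eq:
  assumes "\<And>i. i \<in> {1..n} \<Longrightarrow> 1 \<le> L i"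
  shows "active n \<pi> L (Suc t) = {i \<in> {1..n}. (\<Sum>l\<in>{1..t}. alloc n \<pi> L l i) < L i}"
proof (induction t)
  case 0
  show ?case
    using assms by fastforce
next
  case (Suc t)
  have "active n \<pi> L (Suc (Suc t)) =
      {i \<in> active n \<pi> L (Suc t). (\<Sum>l\<in>{1..Suc t}. alloc n \<pi> L l i) < L i}"
    by (simp add: alloc_def)
  also have "\<dots> = {i \<in> {1..n}. (\<Sum>l\<in>{1..Suc t}. alloc n \<pi> L l i) < L i}"
    unfolding Suc.IH by auto
  finally show ?case .
qed

lemma active_antimono:
  assumes "s \<le> t"
  shows "active n \<pi> L (Suc t) \<subseteq> active n \<pi> L (Suc s)"
  by (rule lift_Suc_antimono_le[where f = "\<lambda>k. active n \<pi> L (Suc k)", OF _ assms]) auto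

lemma finite_active: "finite (active n \<pi> L t)"
  by (rule finite_subset[OF active_subset]) simp

lemma fair_policiesD:
  assumes "\<pi> \<in> fair_policies n C" "1 \<le> t" "M \<subseteq> {1..n}" "M \<noteq> {}"
  shows "fair n C M (\<pi> t M)"
  using assms unfolding fair_policies_def by blast

lemma fair_alloc:
  assumes "\<pi> \<in> fair_policies n C" "active n \<pi> L (Suc t) \<noteq> {}"
  shows "fair n C (active n \<pi> L (Suc t)) (alloc n \<pi> L (Suc t))"
  unfolding alloc_def by (rule fair_policiesD[OF assms(1) _ active_subset assms(2)]) simp

section \<open>Pointwise lower bound on the effective assignments\<close>

text \<open>
  Only a threat that dies in the round wastes effectors, and it wastes at most
  \<open>x\<^sub>i - 1 \<le> C / card M\<close> of them.
\<close>

lemma eam_at_step: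
  assumes \<pi>: "\<pi> \<in> fair_policies n C" and L: "\<And>i. i \<in> {1..n} \<Longrightarrow> 1 \<le> L i"
    and ne: "active n \<pi> L (Suc t) \<noteq> {}"
  shows "card (active n \<pi> L (Suc t)) * eam_at n t \<pi> L + C * card (active n \<pi> L (Suc (Suc t)))
    \<le> card (active n \<pi> L (Suc t)) * eam_at n (Suc t) \<pi> L"
proof -
  let ?cum = "\<lambda>s i. \<Sum>l\<in>{1..s}. alloc n \<pi> L l i"
  define M where "M = active n \<pi> L (Suc t)"
  define M' where "M' = active n \<pi> L (Suc (Suc t))"
  define x where "x = alloc n \<pi> L (Suc t)"
  \<comment> \<open>A lower bound on the effective assignments of this round: a survivor uses all of
    \<open>x i\<close>, and a dying threat, whose residual demand was positive, uses at least one
    effector.\<close>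
  define g where "g i = (if i \<in> M' then x i else 1)" for i
  have M: "M = {i \<in> {1..n}. ?cum t i < L i}" and M': "M' = {i \<in> {1..n}. ?cum (Suc t) i < L i}"
    unfolding M_def M'_def by (intro active_Suc_eq L; simp)+
  have cum: "?cum (Suc t) i = ?cum t i + x i" for i
    by (simp add: x_def)
  have fin: "finite M"
    using M by simp
  have sub: "M' \<subseteq> M"
    by (auto simp: M M' cum)
  have fair: "fair n C M x"
    unfolding M_def x_def by (rule fair_alloc[OF \<pi> ne])
  have "(\<Sum>i\<in>M. card M * x i) \<le> (\<Sum>i\<in>M. card M * g i + (if i \<in> M' then 0 else C))"
    using card_mult_fair_le[OF fair fin] by (intro sum_mono) (auto simp: g_def add.commute)
  also have "\<dots> = card M * (\<Sum>i\<in>M. g i) + (\<Sum>i\<in>M - M'. C)"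
  proof -
    have "(\<Sum>i\<in>M. if i \<in> M' then 0 else C) = (\<Sum>i\<in>M - M'. C)"
      using fin by (intro sum.mono_neutral_cong_right) auto
    then show ?thesis
      by (simp add: sum.distrib sum_distrib_left)
  qed
  also have "(\<Sum>i\<in>M. card M * x i) = card M * C"
    using fair by (simp add: fair_def flip: sum_distrib_left)
  also have "(\<Sum>i\<in>M - M'. C) = card M * C - card M' * C"
    using sub fin by (simp add: card_Diff_subset finite_subset diff_mult_distrib)
  \<comment> \<open>The natural-number difference is not truncated because
    \<open>M' \<subseteq> M\<close>, so it can be moved to the other side.\<close>
  finally have "card M' * C \<le> card M * (\<Sum>i\<in>M. g i)"
    using mult_le_mono1[OF card_mono[OF fin sub], of C] by linarith
  then have main: "C * card M' \<le> card M * (\<Sum>i\<in>M. g i)"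
    by (simp add: mult.commute)
  have "eam_at n t \<pi> L + (\<Sum>i\<in>M. g i) = (\<Sum>i\<in>{1..n}. min (?cum t i) (L i) + (if i \<in> M then g i else 0))"
  proof -
    have "(\<Sum>i\<in>M. g i) = (\<Sum>i\<in>{1..n}. if i \<in> M then g i else 0)"
      by (intro sum.mono_neutral_cong_left) (auto simp: M)
    then show ?thesis
      by (simp add: eam_at_def sum.distrib)
  qed
  also have "\<dots> \<le> (\<Sum>i\<in>{1..n}. min (?cum (Suc t) i) (L i))"
    by (intro sum_mono) (auto simp: M M' x_def g_def)
  finally have "eam_at n t \<pi> L + (\<Sum>i\<in>M. g i) \<le> eam_at n (Suc t) \<pi> L"
    by (simp add: eam_at_def)
  then have "card M * (eam_at n t \<pi> L + (\<Sum>i\<in>M. g i)) \<le> card M * eam_at n (Suc t) \<pi> L"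
    by (rule mult_left_mono) simp
  with main show ?thesis
    by (simp add: M_def M'_def distrib_left)
qed

text \<open>Iterates \<open>eam_at_step\<close>, divided by the number of active threats. A threat
  that survives round \<open>t\<close> keeps all these numbers positive.\<close>

lemma eam_at_ge_sum_ratios:
  assumes \<pi>: "\<pi> \<in> fair_policies n C" and L: "\<And>i. i \<in> {1..n} \<Longrightarrow> 1 \<le> L i"
    and ne: "active n \<pi> L (Suc t) \<noteq> {}"
  shows "real C * (\<Sum>s<t. real (card (active n \<pi> L (Suc (Suc s)))) / real (card (active n \<pi> L (Suc s))))
    \<le> real (eam_at n t \<pi> L)"
  using ne
proof (induction t)
  case 0
  show ?case by simp
next
  case (Suc t)
  define m where "m s = real (card (active n \<pi> L (Suc s)))" for s
  have ne: "active n \<pi> L (Suc t) \<noteq> {}"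
    using Suc.prems active_antimono[of t "Suc t"] by fastforce
  then have pos: "m t > 0"
    using finite_active by (auto simp: m_def card_gt_0_iff)
  have "m t * real (eam_at n t \<pi> L) + real C * m (Suc t) \<le> m t * real (eam_at n (Suc t) \<pi> L)"
    unfolding m_def using eam_at_step[OF \<pi> L ne] by (simp flip: of_nat_mult of_nat_add del: active.simps)
  then have "real (eam_at n t \<pi> L) + real C * (m (Suc t) / m t) \<le> real (eam_at n (Suc t) \<pi> L)"
    using pos by (simp add: field_simps)
  moreover have "real C * (\<Sum>s<t. m (Suc s) / m s) \<le> real (eam_at n t \<pi> L)"
    using Suc.IH[OF ne] unfolding m_def .
  ultimately have "real C * (\<Sum>s<Suc t. m (Suc s) / m s) \<le> real (eam_at n (Suc t) \<pi> L)"
    by (simp add: distrib_left)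
  then show ?case
    unfolding m_def .
qed

text \<open>The product form serves both the ratio bound for fixed demands and the integration over
  random demands in one round.\<close>

lemma eam_at_ge:
  assumes \<pi>: "\<pi> \<in> fair_policies n C" and L: "\<And>i. i \<in> {1..n} \<Longrightarrow> 1 \<le> L i"
    and n: "1 \<le> n" and \<tau>: "1 \<le> \<tau>"
  shows "real n powr (- 1 / real \<tau>) * real (min (C * \<tau>) (\<Sum>i\<in>{1..n}. L i)) \<le> real (eam_at n \<tau> \<pi> L)"
proof (cases "active n \<pi> L (Suc \<tau>) = {}")
  case True
  then have "L i \<le> (\<Sum>l\<in>{1..\<tau>}. alloc n \<pi> L l i)" if "i \<in> {1..n}" for i
    using that L by (subst (asm) active_Suc_eq) (auto simp: not_less)
  then have "eam_at n \<tau> \<pi> L = (\<Sum>i\<in>{1..n}. L i)"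
    unfolding eam_at_def by (intro sum.cong) (auto simp: min_absorb2)
  moreover have "real n powr (- 1 / real \<tau>) \<le> 1"
    using n by (simp add: powr_le_one_le ge_one_powr_ge_zero powr_minus_divide)
  then have "real n powr (- 1 / real \<tau>) * real (min (C * \<tau>) (\<Sum>i\<in>{1..n}. L i))
      \<le> 1 * real (\<Sum>i\<in>{1..n}. L i)"
    by (intro mult_mono of_nat_mono) simp_all
  ultimately show ?thesis
    by simp
next
  case False
  define m where "m s = real (card (active n \<pi> L (Suc s)))" for s
  have m_pos: "m s > 0" if "s \<le> \<tau>" for s
  proof -
    have "active n \<pi> L (Suc s) \<noteq> {}"
      using active_antimono[OF that, of n \<pi> L] False by blast
    then show ?thesis
      using finite_active by (simp add: m_def card_gt_0_iff)
  qed
  have m_tau: "m \<tau> \<ge> 1"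
    using m_pos[of \<tau>] by (simp add: m_def)
  have m0: "m 0 = real n"
    by (simp add: m_def)
  \<comment> \<open>The ratios telescope to \<open>m \<tau> / m 0\<close>, which is at least
    \<open>1 / n\<close> because a threat survives round \<open>\<tau>\<close>. AM-GM then replaces
    their geometric mean by the arithmetic mean.\<close>
  have "real n powr (- 1 / real \<tau>) = (1 / real n) powr (1 / real \<tau>)"
    using n by (simp add: powr_divide powr_minus_divide)
  also have "\<dots> \<le> (m \<tau> / m 0) powr (1 / real \<tau>)"
    using m_tau n by (intro powr_mono2) (auto simp: m0 divide_right_mono)
  also have "m \<tau> / m 0 = (\<Prod>s<\<tau>. m (Suc s) / m s)"
    using m_pos by (intro prod_lessThan_telescope[symmetric]) (metis less_irrefl)
  also have "\<dots> powr (1 / real \<tau>) \<le> (\<Sum>s<\<tau>. (m (Suc s) / m s) / real \<tau>)"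
    using arith_geom_mean[of "{..<\<tau>}" "\<lambda>s. m (Suc s) / m s"] \<tau> by (auto simp: m_def lessThan_empty_iff)
  also have "\<dots> = (\<Sum>s<\<tau>. m (Suc s) / m s) / real \<tau>"
    by (simp add: sum_divide_distrib)
  finally have "real n powr (- 1 / real \<tau>) * (real C * real \<tau>) \<le> real C * (\<Sum>s<\<tau>. m (Suc s) / m s)"
    using \<tau> mult_left_mono[of "real n powr (- 1 / real \<tau>) * real \<tau>" "\<Sum>s<\<tau>. m (Suc s) / m s" "real C"]
    by (simp add: pos_le_divide_eq mult.left_commute mult.commute)
  also have "\<dots> \<le> real (eam_at n \<tau> \<pi> L)"
    using eam_at_ge_sum_ratios[OF \<pi> L False] unfolding m_def .
  finally have "real n powr (- 1 / real \<tau>) * real (C * \<tau>) \<le> real (eam_at n \<tau> \<pi> L)"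
    by simp
  moreover have "real n powr (- 1 / real \<tau>) * real (min (C * \<tau>) (\<Sum>i\<in>{1..n}. L i))
      \<le> real n powr (- 1 / real \<tau>) * real (C * \<tau>)"
    by (intro mult_left_mono of_nat_mono) auto
  ultimately show ?thesis
    by linarith
qed

lemma eam_at_ratio_ge:
  assumes "\<pi> \<in> fair_policies n C" "L \<in> demands n" "1 \<le> n" "1 \<le> \<tau>" "1 \<le> C"
  shows "real n powr (- 1 / real \<tau>) \<le> real (eam_at n \<tau> \<pi> L) / real (min (C * \<tau>) (\<Sum>i\<in>{1..n}. L i))"
proof -
  have L: "1 \<le> L i" if "i \<in> {1..n}" for i
    using assms(2) that by (auto simp: demands_def)
  have "(\<Sum>i\<in>{1..n}. 1) \<le> (\<Sum>i\<in>{1..n}. L i)"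
    using L by (intro sum_mono) auto
  then have "0 < min (C * \<tau>) (\<Sum>i\<in>{1..n}. L i)"
    using assms(3-5) by simp
  then show ?thesis
    using eam_at_ge[OF assms(1) L assms(3,4)] by (simp only: pos_le_divide_eq of_nat_0_less_iff)
qed

section \<open>One-round comparison with the optimum under random demands\<close>

lemma eam_at_le_capacity:
  assumes "\<pi> \<in> policies n C"
  shows "eam_at n \<tau> \<pi> L \<le> C * \<tau>"
proof -
  have "eam_at n \<tau> \<pi> L \<le> (\<Sum>i\<in>{1..n}. \<Sum>t\<in>{1..\<tau>}. alloc n \<pi> L t i)"
    unfolding eam_at_def by (intro sum_mono) simp
  also have "\<dots> = (\<Sum>t\<in>{1..\<tau>}. \<Sum>i\<in>{1..n}. alloc n \<pi> L t i)"
    by (rule sum.swap)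
  also have "\<dots> \<le> (\<Sum>t\<in>{1..\<tau>}. C)"
  proof (rule sum_mono)
    fix t assume "t \<in> {1..\<tau>}"
    then have "1 \<le> t"
      by simp
    then show "(\<Sum>i\<in>{1..n}. alloc n \<pi> L t i) \<le> C"
      using assms active_subset[of n \<pi> L t] unfolding policies_def alloc_def by blast
  qed
  finally show ?thesis
    by (simp add: mult.commute)
qed

lemma eam_at_le_demand: "eam_at n \<tau> \<pi> L \<le> (\<Sum>i\<in>{1..n}. L i)"
  unfolding eam_at_def by (intro sum_mono) simp

text \<open>Supplies two facts about the support: demands are at least 1, and a threat with
  \<open>q i = 0\<close> has demand exactly 1, since \<open>geometric_pmf 1\<close> is concentrated
  at 0.\<close>

lemma set_pmf_demand_component:
  assumes "L \<in> set_pmf (demand_pmf n q)" "i \<in> {1..n}"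
  shows "L i \<in> Suc ` set_pmf (geometric_pmf (1 - q i))"
  using assms set_Pi_pmf_subset'[of "{1..n}"] unfolding demand_pmf_def by (fastforce simp: PiE_dflt_def)

lemma integrable_eam_at:
  assumes "\<pi> \<in> policies n C"
  shows "integrable (measure_pmf (demand_pmf n q)) (\<lambda>L. real (eam_at n \<tau> \<pi> L))"
proof (rule measure_pmf.integrable_const_bound[where B = "real (C * \<tau>)"])
  show "AE L in measure_pmf (demand_pmf n q). norm (real (eam_at n \<tau> \<pi> L)) \<le> real (C * \<tau>)"
    by (intro AE_I2) (use eam_at_le_capacity[OF assms] in \<open>simp flip: of_nat_mult\<close>)
qed simp

text \<open>For each realization, \<open>min C (\<Sum>i\<in>{1..n}. L i)\<close> separates the two
  sides: no policy exceeds it, and the fair policy reaches a \<open>1 / n\<close> fraction of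
  it.\<close>

lemma eam_one_round_le:
  assumes \<pi>: "\<pi> \<in> fair_policies n C" and \<pi>': "\<pi>' \<in> policies n C" and n: "1 \<le> n"
  shows "eam n 1 q \<pi>' \<le> real n * eam n 1 q \<pi>"
proof -
  have "\<pi> \<in> policies n C"
    using \<pi> by (simp add: fair_policies_def)
  note int = integrable_eam_at[OF this] integrable_eam_at[OF \<pi>']
  have "real (eam_at n 1 \<pi>' L) \<le> real n * real (eam_at n 1 \<pi> L)" if "L \<in> set_pmf (demand_pmf n q)" for L
  proof -
    have L: "1 \<le> L i" if "i \<in> {1..n}" for i
      using set_pmf_demand_component[OF \<open>L \<in> _\<close> that] by auto
    have "real (eam_at n 1 \<pi>' L) \<le> real (min (C * 1) (\<Sum>i\<in>{1..n}. L i))"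
      using eam_at_le_capacity[OF \<pi>', of 1 L] eam_at_le_demand[of n 1 \<pi>' L] by (intro of_nat_mono) simp
    also have "\<dots> \<le> real n * real (eam_at n 1 \<pi> L)"
      using eam_at_ge[where L = L and \<tau> = 1, OF \<pi> L n] n by (simp add: powr_minus field_simps)
    finally show ?thesis .
  qed
  then have "eam n 1 q \<pi>' \<le> measure_pmf.expectation (demand_pmf n q) (\<lambda>L. real n * real (eam_at n 1 \<pi> L))"
    unfolding eam_def by (intro integral_mono_AE int integrable_mult_right AE_pmfI) auto
  then show ?thesis
    by (simp add: eam_def)
qed

text \<open>Makes \<open>eam_opt\<close> positive, so that the ratio to it is a genuine quotient. On
  the support the count is positive, hence at least 1 by integrality.\<close>

lemma eam_fair_pos:
  assumes \<pi>: "\<pi> \<in> fair_policies n C" and n: "1 \<le> n" and C: "1 \<le> C"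
  shows "0 < eam n 1 q \<pi>"
proof -
  have pol: "\<pi> \<in> policies n C"
    using \<pi> by (simp add: fair_policies_def)
  have "1 \<le> real (eam_at n 1 \<pi> L)" if "L \<in> set_pmf (demand_pmf n q)" for L
  proof -
    have L: "1 \<le> L i" if "i \<in> {1..n}" for i
      using set_pmf_demand_component[OF \<open>L \<in> _\<close> that] by auto
    have "1 \<le> (\<Sum>i\<in>{1..n}. L i)"
      using L[of 1] n member_le_sum[of 1 "{1..n}" L] by simp
    then have "0 < real n powr (- 1 / real 1) * real (min (C * 1) (\<Sum>i\<in>{1..n}. L i))"
      using n C by simp
    then have "0 < real (eam_at n 1 \<pi> L)"
      using eam_at_ge[where L = L and \<tau> = 1, OF \<pi> L n] by linarith
    then show ?thesis
      by simp
  qed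
  then have "1 \<le> eam n 1 q \<pi>"
    unfolding eam_def
    by (intro measure_pmf.integral_ge_const integrable_eam_at[OF pol] AE_pmfI) auto
  then show ?thesis
    by simp
qed

lemma eam_one_round_ratio_ge:
  assumes \<pi>: "\<pi> \<in> fair_policies n C" and n: "1 \<le> n" and C: "1 \<le> C"
  shows "1 / real n \<le> eam n 1 q \<pi> / eam_opt n C 1 q"
proof -
  have pol: "\<pi> \<in> policies n C"
    using \<pi> by (simp add: fair_policies_def)
  have "eam n 1 q \<pi> \<le> eam_opt n C 1 q"
    unfolding eam_opt_def by (intro Max_ge finite_eam_policies imageI pol)
  then have pos: "0 < eam_opt n C 1 q"
    using eam_fair_pos[OF assms, of q] by linarith
  have "y \<le> real n * eam n 1 q \<pi>" if "y \<in> eam n 1 q ` policies n C" for y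
    using that eam_one_round_le[OF \<pi> _ n] by blast
  then have "eam_opt n C 1 q \<le> real n * eam n 1 q \<pi>"
    unfolding eam_opt_def using pol by (intro Max.boundedI finite_eam_policies) blast+
  then show ?thesis
    using pos n by (simp add: field_simps)
qed

section \<open>Tightness for one round with random demands\<close>

text \<open>A competitor bounding \<open>eam_opt\<close> from below: in round 1 it sends everything
  to threat 1. Using \<open>Min M\<close> instead of the fixed threat 1 spends the full capacity on
  active threats for every nonempty \<open>M\<close>, as \<open>policies\<close> demands.\<close>

definition focused_policy :: "nat \<Rightarrow> policy" where
  "focused_policy C t M i = (if M \<noteq> {} \<and> i = Min M then C else 0)"

lemma focused_policy_in_policies: "focused_policy C \<in> policies n C"
proof -
  have "(\<Sum>i\<in>{1..n}. focused_policy C t M i) \<le> C \<and> (M \<noteq> {} \<longrightarrow> (\<Sum>i\<in>M. focused_policy C t M i) = C)"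
    if "M \<subseteq> {1..n}" for t M
  proof -
    have fin: "finite M"
      using that finite_subset by blast
    have "(\<Sum>i\<in>A. focused_policy C t M i) = (if M \<noteq> {} \<and> Min M \<in> A then C else 0)" if "finite A" for A
      using that by (cases "M = {}") (simp_all add: focused_policy_def)
    from this[of "{1..n}"] this[OF fin] show ?thesis
      using fin by simp
  qed
  then show ?thesis
    by (simp add: policies_def)
qed

text \<open>Only the event \<open>C < L 1\<close>, of probability \<open>q 1 ^ C\<close>, is
  counted; on it none of the \<open>C\<close> effectors sent to threat 1 is wasted.\<close>

lemma eam_focused_policy_ge:
  assumes q: "q \<in> difficulties n" and n: "1 \<le> n"
  shows "real C * q 1 ^ C \<le> eam n 1 q (focused_policy C)"
proof -
  let ?D = "demand_pmf n q"
  have "1 \<in> {1..n}"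
    using n by simp
  then have q1: "0 \<le> q 1" "q 1 < 1"
    using q unfolding difficulties_def by fastforce+
  have "Min {1..n} = 1"
    using n by (intro Min_eqI) auto
  then have at: "C * of_bool (C < L 1) \<le> eam_at n 1 (focused_policy C) L" for L
    using n member_le_sum[of 1 "{1..n}" "\<lambda>i. min (alloc n (focused_policy C) L 1 i) (L i)"]
    by (auto simp: eam_at_def alloc_def focused_policy_def)
  have "q 1 ^ C = measure_pmf.prob (map_pmf (\<lambda>L. L 1) ?D) {C<..}"
    using n demand_tail[OF q1] by (simp add: demand_pmf_def Pi_pmf_component)
  also have "\<dots> = measure_pmf.prob ?D {L. C < L 1}"
    by (simp add: measure_map_pmf vimage_def)
  finally have "real C * q 1 ^ C = measure_pmf.expectation ?D (\<lambda>L. real C * indicator {L. C < L 1} L)"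
    by simp
  also have "\<dots> \<le> eam n 1 q (focused_policy C)"
    unfolding eam_def
  proof (intro integral_mono integrable_eam_at[OF focused_policy_in_policies])
    show "real C * indicator {L. C < L 1} L \<le> real (eam_at n 1 (focused_policy C) L)" for L
      using of_nat_mono[OF at[of L], where 'a = real] by (simp add: indicator_def split: if_splits)
  qed (auto intro: measure_pmf.integrable_const_bound[where B = "real C"] simp: indicator_def)
  finally show ?thesis .
qed

text \<open>Threat 1 gets at most its fair share \<open>k\<close>, and each of the other
  \<open>n - 1\<close> threats has demand 1 almost surely, so it absorbs at most one
  effector.\<close>

lemma eam_fair_le:
  assumes \<pi>: "\<pi> \<in> fair_policies n (k * n)" and q: "\<And>i. i \<in> {2..n} \<Longrightarrow> q i = 0" and n: "1 \<le> n"
  shows "eam n 1 q \<pi> \<le> real (k + (n - 1))"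
proof -
  have pol: "\<pi> \<in> policies n (k * n)"
    using \<pi> by (simp add: fair_policies_def)
  have "fair n (k * n) {1..n} (\<pi> 1 {1..n})"
    using n by (intro fair_policiesD[OF \<pi>]) auto
  then have x: "\<pi> 1 {1..n} 1 \<le> k"
    using n by (rule_tac fair_le_ceiling) auto
  have "eam_at n 1 \<pi> L \<le> k + (n - 1)" if "L \<in> set_pmf (demand_pmf n q)" for L
  proof -
    have "min (\<pi> 1 {1..n} i) (L i) \<le> (if i = 1 then k else 1)" if "i \<in> {1..n}" for i
      using set_pmf_demand_component[OF \<open>L \<in> _\<close> that] q[of i] x that by (cases "i = 1") auto
    then have "eam_at n 1 \<pi> L \<le> (\<Sum>i\<in>{1..n}. if i = 1 then k else 1)"
      unfolding eam_at_def by (intro sum_mono) (simp add: alloc_def)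
    also have "{1..n} = insert 1 {2..n}"
      using n by auto
    also have "(\<Sum>i\<in>insert 1 {2..n}. if i = 1 then k else 1) = k + (\<Sum>i\<in>{2..n}. 1)"
      by (subst sum.insert) (auto intro!: sum.cong)
    finally show ?thesis
      using n by simp
  qed
  then show ?thesis
    unfolding eam_def
    by (intro measure_pmf.integral_le_const integrable_eam_at[OF pol] AE_pmfI of_nat_mono) auto
qed

lemma one_round_ratio_small:
  assumes \<pi>: "\<pi> \<in> fair_policies n (k * n)" and n: "1 \<le> n" and k: "1 \<le> k"
  obtains q where "q \<in> difficulties n"
    and "eam n 1 q \<pi> / eam_opt n (k * n) 1 q \<le> real (k + (n - 1)) * real (k + 1) / (real k * real k * real n)"
proof -
  define C where "C = k * n"
  \<comment> \<open>Chosen so that Bernoulli's inequality gives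
    \<open>(1 - e) ^ C \<ge> 1 - C * e = k / (k + 1)\<close>: the focused policy loses only a
    vanishing fraction of \<open>C\<close>, although \<open>C\<close> grows with
    \<open>k\<close>.\<close>
  define e where "e = 1 / (real C * real (k + 1))"
  define q where "q = (\<lambda>i\<in>{1..n}. if i = 1 then 1 - e else 0)"
  have C: "1 \<le> C"
    using n k by (simp add: C_def)
  then have "1 * 1 \<le> real C * real (k + 1)"
    by (intro mult_mono) auto
  then have e: "0 < e" "e \<le> 1"
    using C by (auto simp: e_def)
  then have q: "q \<in> difficulties n"
    by (auto simp: q_def difficulties_def)
  have "real C * e = 1 / real (k + 1)"
    using C by (simp add: e_def)
  then have "real k / real (k + 1) = 1 - real C * e"
    by (simp add: field_simps)
  also have "\<dots> \<le> (1 - e) ^ C"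
    using Bernoulli_inequality[of "- e" C] e by simp
  finally have "real C * (real k / real (k + 1)) \<le> real C * q 1 ^ C"
    using n by (intro mult_left_mono) (auto simp: q_def)
  also have "\<dots> \<le> eam n 1 q (focused_policy C)"
    by (rule eam_focused_policy_ge[OF q n])
  also have "\<dots> \<le> eam_opt n C 1 q"
    unfolding eam_opt_def by (intro Max_ge finite_eam_policies imageI focused_policy_in_policies)
  finally have opt: "real C * (real k / real (k + 1)) \<le> eam_opt n C 1 q" .
  have "eam n 1 q \<pi> \<le> real (k + (n - 1))"
    by (rule eam_fair_le[OF \<pi> _ n]) (auto simp: q_def)
  then have "eam n 1 q \<pi> / eam_opt n C 1 q \<le> real (k + (n - 1)) / (real C * (real k / real (k + 1)))"
    using opt k C by (intro frac_le) auto
  also have "\<dots> = real (k + (n - 1)) * real (k + 1) / (real k * real k * real n)"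
    by (simp add: C_def mult_ac)
  finally show thesis
    using that[OF q] by (simp add: C_def)
qed

section \<open>Tightness for fixed demands: the worst case\<close>

text \<open>
  The worst case for \<open>n = b ^ \<tau>\<close>: threat \<open>i\<close> survives round \<open>l + 1\<close> iff \<open>i \<le> b ^ (\<tau> - l - 1)\<close>.
  The active set thus shrinks by the factor \<open>b\<close> in each round, and every threat that dies needs
  just one effector in its last round; the last summand makes the total demand exceed the capacity.
\<close>

definition worst_demand :: "nat \<Rightarrow> nat \<Rightarrow> nat \<Rightarrow> nat \<Rightarrow> nat" where
  "worst_demand b \<tau> k = (\<lambda>i\<in>{1..b ^ \<tau>}.
     1 + (\<Sum>l<\<tau>. if i \<le> b ^ (\<tau> - Suc l) then k * b ^ l else 0) + (if i = 1 then k * b ^ \<tau> * \<tau> else 0))"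

text \<open>Strong induction on the round. By the earlier bounds, threats
  \<open>1..b ^ (\<tau> - s)\<close> have not yet met their demands, so at least
  \<open>b ^ (\<tau> - s)\<close> threats share \<open>k * b ^ \<tau>\<close> effectors and none
  gets more than \<open>k * b ^ s\<close>.\<close>

lemma alloc_worst_demand_le:
  assumes \<pi>: "\<pi> \<in> fair_policies (b ^ \<tau>) (k * b ^ \<tau>)" and b: "1 \<le> b"
    and "l < \<tau>" "i \<in> {1..b ^ \<tau>}"
  shows "alloc (b ^ \<tau>) \<pi> (worst_demand b \<tau> k) (Suc l) i \<le> k * b ^ l"
  using assms(3,4)
proof (induction l arbitrary: i rule: less_induct)
  case (less s)
  let ?n = "b ^ \<tau>" and ?L = "worst_demand b \<tau> k"
  let ?M = "active ?n \<pi> ?L (Suc s)"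
  have sub: "{1..b ^ (\<tau> - s)} \<subseteq> ?M"
  proof
    fix j assume j: "j \<in> {1..b ^ (\<tau> - s)}"
    moreover have "b ^ (\<tau> - s) \<le> b ^ \<tau>"
      using b by (intro power_increasing) auto
    ultimately have jn: "j \<in> {1..?n}"
      by simp
    have "(\<Sum>l\<in>{1..s}. alloc ?n \<pi> ?L l j) = (\<Sum>l<s. alloc ?n \<pi> ?L (Suc l) j)"
      by (simp add: sum.atLeast1_atMost_eq)
    also have "\<dots> \<le> (\<Sum>l<s. if j \<le> b ^ (\<tau> - Suc l) then k * b ^ l else 0)"
    proof (rule sum_mono)
      \<comment> \<open>For \<open>l < s\<close> the condition
        \<open>j \<le> b ^ (\<tau> - Suc l)\<close> holds, so the summand is the full
        \<open>k * b ^ l\<close>.\<close>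
      fix l assume "l \<in> {..<s}"
      then have "b ^ (\<tau> - s) \<le> b ^ (\<tau> - Suc l)"
        using b by (intro power_increasing) auto
      then show "alloc ?n \<pi> ?L (Suc l) j \<le> (if j \<le> b ^ (\<tau> - Suc l) then k * b ^ l else 0)"
        using less.IH[of l j] \<open>l \<in> _\<close> less.prems(1) j jn by simp
    qed
    also have "\<dots> \<le> (\<Sum>l<\<tau>. if j \<le> b ^ (\<tau> - Suc l) then k * b ^ l else 0)"
      using less.prems(1) by (intro sum_mono2) auto
    \<comment> \<open>Strict because of the leading 1 in \<open>worst_demand\<close>.\<close>
    also have "\<dots> < ?L j"
      using jn by (simp add: worst_demand_def)
    finally have "(\<Sum>l\<in>{1..s}. alloc ?n \<pi> ?L l j) < ?L j" .
    then show "j \<in> ?M"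
      using jn by (subst active_Suc_eq) (auto simp: worst_demand_def)
  qed
  have ne: "?M \<noteq> {}"
    using sub b by fastforce
  note fair = fair_alloc[OF \<pi> ne]
  have "b ^ (\<tau> - s) \<le> card ?M"
    using card_mono[OF finite_active sub] by simp
  then have "k * b ^ s * b ^ (\<tau> - s) \<le> k * b ^ s * card ?M"
    by (rule mult_left_mono) simp
  then have "k * ?n \<le> k * b ^ s * card ?M"
    using less.prems(1) by (simp add: mult.assoc flip: power_add)
  then show ?case
    using fair_le_ceiling[OF fair finite_active] fair less.prems(2)
    by (cases "i \<in> ?M") (auto simp: fair_def)
qed

text \<open>Threat 1, whose demand is inflated, is bounded by its allocation, and all others by
  their demand. After swapping the sums, each round contributes \<open>b ^ (\<tau> - Suc l)\<close>
  threats times \<open>k * b ^ l\<close>, which is independent of \<open>l\<close>.\<close>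

lemma eam_at_worst_demand_le:
  assumes \<pi>: "\<pi> \<in> fair_policies (b ^ \<tau>) (k * b ^ \<tau>)" and b: "1 \<le> b" and \<tau>: "1 \<le> \<tau>"
  shows "eam_at (b ^ \<tau>) \<tau> \<pi> (worst_demand b \<tau> k) \<le> b ^ \<tau> + \<tau> * (k * b ^ (\<tau> - 1))"
proof -
  let ?n = "b ^ \<tau>" and ?L = "worst_demand b \<tau> k"
  let ?d = "\<lambda>i l. if i \<le> b ^ (\<tau> - Suc l) then k * b ^ l else 0"
  have "min (\<Sum>t\<in>{1..\<tau>}. alloc ?n \<pi> ?L t i) (?L i) \<le> 1 + (\<Sum>l<\<tau>. ?d i l)" if i: "i \<in> {1..?n}" for i
  proof (cases "i = 1")
    case True
    have "(\<Sum>t\<in>{1..\<tau>}. alloc ?n \<pi> ?L t i) = (\<Sum>l<\<tau>. alloc ?n \<pi> ?L (Suc l) i)"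
      by (simp add: sum.atLeast1_atMost_eq)
    also have "\<dots> \<le> (\<Sum>l<\<tau>. ?d i l)"
      using alloc_worst_demand_le[OF \<pi> b _ i] True b by (intro sum_mono) simp
    finally show ?thesis
      by simp
  next
    case False
    then show ?thesis
      using i by (simp add: worst_demand_def)
  qed
  then have "eam_at ?n \<tau> \<pi> ?L \<le> (\<Sum>i\<in>{1..?n}. 1 + (\<Sum>l<\<tau>. ?d i l))"
    unfolding eam_at_def by (intro sum_mono) auto
  also have "\<dots> = ?n + (\<Sum>i\<in>{1..?n}. \<Sum>l<\<tau>. ?d i l)"
    unfolding sum.distrib by simp
  also have "(\<Sum>i\<in>{1..?n}. \<Sum>l<\<tau>. ?d i l) = (\<Sum>l<\<tau>. \<Sum>i\<in>{1..?n}. ?d i l)"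
    by (rule sum.swap)
  also have "\<dots> = (\<Sum>l<\<tau>. k * b ^ (\<tau> - 1))"
  proof (rule sum.cong)
    fix l assume "l \<in> {..<\<tau>}"
    have "b ^ (\<tau> - Suc l) \<le> ?n"
      using b by (intro power_increasing) auto
    then have "(\<Sum>i\<in>{1..?n}. ?d i l) = (\<Sum>i\<in>{1..b ^ (\<tau> - Suc l)}. k * b ^ l)"
      by (intro sum.mono_neutral_cong_right) auto
    also have "\<dots> = k * (b ^ (\<tau> - Suc l) * b ^ l)"
      by simp
    also have "b ^ (\<tau> - Suc l) * b ^ l = b ^ (\<tau> - 1)"
      using \<open>l \<in> _\<close> by (simp flip: power_add)
    finally show "(\<Sum>i\<in>{1..?n}. ?d i l) = k * b ^ (\<tau> - 1)" .
  qed simp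
  finally show ?thesis
    by simp
qed

lemma worst_demand_ratio_le:
  assumes \<pi>: "\<pi> \<in> fair_policies (b ^ \<tau>) (k * b ^ \<tau>)" and b: "1 \<le> b" and \<tau>: "1 \<le> \<tau>" and k: "1 \<le> k"
  shows "real (eam_at (b ^ \<tau>) \<tau> \<pi> (worst_demand b \<tau> k))
      / real (min (k * b ^ \<tau> * \<tau>) (\<Sum>i\<in>{1..b ^ \<tau>}. worst_demand b \<tau> k i))
    \<le> 1 / real b + 1 / real \<tau> * (1 / real k)"
proof -
  let ?L = "worst_demand b \<tau> k"
  \<comment> \<open>The extra summand of threat 1 alone reaches the total capacity, so the minimum
    in the denominator is the capacity.\<close>
  have "k * b ^ \<tau> * \<tau> \<le> ?L 1"
    using b by (simp add: worst_demand_def)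
  also have "\<dots> \<le> (\<Sum>i\<in>{1..b ^ \<tau>}. ?L i)"
    using b by (intro member_le_sum) auto
  finally have "min (k * b ^ \<tau> * \<tau>) (\<Sum>i\<in>{1..b ^ \<tau>}. ?L i) = k * b ^ \<tau> * \<tau>"
    by simp
  moreover have "real (eam_at (b ^ \<tau>) \<tau> \<pi> ?L) \<le> real (b ^ \<tau> + \<tau> * (k * b ^ (\<tau> - 1)))"
    by (intro of_nat_mono eam_at_worst_demand_le assms)
  moreover have "real (b ^ \<tau> + \<tau> * (k * b ^ (\<tau> - 1))) / real (k * b ^ \<tau> * \<tau>)
      = 1 / real b + 1 / real \<tau> * (1 / real k)"
  proof -
    define X where "X = real b ^ (\<tau> - 1)"
    then have "real b ^ (\<tau> - Suc 0) = X" "real b ^ \<tau> = real b * X"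
      using \<tau> by (simp_all add: power_eq_if)
    moreover have "X \<noteq> 0"
      using b by (simp add: X_def)
    ultimately show ?thesis
      using b \<tau> k by (simp add: field_simps)
  qed
  ultimately show ?thesis
    by (metis divide_right_mono of_nat_0_le_iff)
qed

section \<open>Limits of the infima and the final theorem\<close>

text \<open>The infimum is squeezed between the general lower bound and the ratio at
  \<open>worst_demand\<close>, which exceeds \<open>1 / b\<close> by at most
  \<open>1 / (\<tau> * k)\<close>.\<close>

lemma tendsto_INF_eam_at_ratio:
  fixes \<pi> :: "nat \<Rightarrow> policy"
  assumes b: "1 \<le> b" and \<tau>: "1 \<le> \<tau>" and n: "n = b ^ \<tau>"
    and \<pi>: "\<And>C. C \<ge> 1 \<Longrightarrow> \<pi> C \<in> fair_policies n C"
  shows "(\<lambda>k. INF L \<in> demands n.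
      real (eam_at n \<tau> (\<pi> (k * n)) L) / real (min (k * n * \<tau>) (\<Sum>i\<in>{1..n}. L i))) \<longlonglongrightarrow> 1 / real b"
proof -
  let ?r = "\<lambda>k L. real (eam_at n \<tau> (\<pi> (k * n)) L) / real (min (k * n * \<tau>) (\<Sum>i\<in>{1..n}. L i))"
  have n1: "1 \<le> n"
    using b n by simp
  have root: "real n powr (- 1 / real \<tau>) = 1 / real b"
    using b \<tau> by (simp add: n powr_minus_divide powr_powr flip: powr_realpow)
  have mem: "worst_demand b \<tau> k \<in> demands n" for k
    by (auto simp: demands_def worst_demand_def n)
  have bounds: "1 / real b \<le> (INF L \<in> demands n. ?r k L)"
      "(INF L \<in> demands n. ?r k L) \<le> 1 / real b + 1 / real \<tau> * (1 / real k)" if k: "1 \<le> k" for k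
  proof -
    have C: "1 \<le> k * n"
      using k n1 by simp
    show "1 / real b \<le> (INF L \<in> demands n. ?r k L)"
      using mem eam_at_ratio_ge[OF \<pi>[OF C] _ n1 \<tau> C] unfolding root by (intro cINF_greatest) auto
    have "(INF L \<in> demands n. ?r k L) \<le> ?r k (worst_demand b \<tau> k)"
      by (intro cINF_lower mem bdd_belowI2[where m = 0]) simp
    also have "\<dots> \<le> 1 / real b + 1 / real \<tau> * (1 / real k)"
      using worst_demand_ratio_le[OF _ b \<tau> k] \<pi>[OF C] by (simp add: n)
    finally show "(INF L \<in> demands n. ?r k L) \<le> 1 / real b + 1 / real \<tau> * (1 / real k)" .
  qed
  have "(\<lambda>k. 1 / real b + 1 / real \<tau> * (1 / real k)) \<longlonglongrightarrow> 1 / real b + 1 / real \<tau> * 0"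
    by (intro tendsto_intros lim_1_over_n)
  then have lim: "(\<lambda>k. 1 / real b + 1 / real \<tau> * (1 / real k)) \<longlonglongrightarrow> 1 / real b"
    by simp
  \<comment> \<open>The bounds hold for \<open>k \<ge> 1\<close> only: at \<open>k = 0\<close> the
    capacity is 0, where \<open>\<pi>\<close> is not assumed fair.\<close>
  have "\<forall>\<^sub>F k in sequentially. 1 / real b \<le> (INF L \<in> demands n. ?r k L)"
    using bounds(1) by (rule eventually_sequentiallyI)
  moreover have "\<forall>\<^sub>F k in sequentially. (INF L \<in> demands n. ?r k L) \<le> 1 / real b + 1 / real \<tau> * (1 / real k)"
    using bounds(2) by (rule eventually_sequentiallyI)
  ultimately show ?thesis
    by (rule tendsto_sandwich[OF _ _ tendsto_const lim])
qed

text \<open>Holds for every \<open>n \<ge> 1\<close>: for one round the root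
  \<open>n powr (1 / \<tau>)\<close> is \<open>n\<close> itself, hence always an integer.\<close>

lemma tendsto_INF_eam_one_round_ratio:
  fixes \<pi> :: "nat \<Rightarrow> policy"
  assumes n: "1 \<le> n" and \<pi>: "\<And>C. C \<ge> 1 \<Longrightarrow> \<pi> C \<in> fair_policies n C"
  shows "(\<lambda>k. INF q \<in> difficulties n. eam n 1 q (\<pi> (k * n)) / eam_opt n (k * n) 1 q) \<longlonglongrightarrow> 1 / real n"
proof -
  let ?r = "\<lambda>k q. eam n 1 q (\<pi> (k * n)) / eam_opt n (k * n) 1 q"
  \<comment> \<open>The bound of \<open>one_round_ratio_small\<close>, rewritten in terms of
    \<open>1 / k\<close> so that its limit can be read off.\<close>
  let ?u = "\<lambda>k. (1 + real (n - 1) * (1 / real k)) * (1 + 1 / real k) * (1 / real n)"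
  have mem: "(\<lambda>i\<in>{1..n}. 0) \<in> difficulties n"
    by (auto simp: difficulties_def)
  have bounds: "1 / real n \<le> (INF q \<in> difficulties n. ?r k q)"
      "(INF q \<in> difficulties n. ?r k q) \<le> ?u k" if k: "1 \<le> k" for k
  proof -
    have C: "1 \<le> k * n"
      using k n by simp
    note ge = eam_one_round_ratio_ge[OF \<pi>[OF C] n C]
    show "1 / real n \<le> (INF q \<in> difficulties n. ?r k q)"
      using mem ge by (intro cINF_greatest) auto
    obtain q where q: "q \<in> difficulties n"
      and le: "?r k q \<le> real (k + (n - 1)) * real (k + 1) / (real k * real k * real n)"
      using one_round_ratio_small[OF \<pi>[OF C] n k] .
    have "(INF q \<in> difficulties n. ?r k q) \<le> ?r k q"
      by (intro cINF_lower q bdd_belowI2[where m = "1 / real n"] ge)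
    also note le
    also have "real (k + (n - 1)) * real (k + 1) / (real k * real k * real n) = ?u k"
      using k n by (simp add: divide_simps) (simp add: algebra_simps)
    finally show "(INF q \<in> difficulties n. ?r k q) \<le> ?u k" .
  qed
  have "?u \<longlonglongrightarrow> (1 + real (n - 1) * 0) * (1 + 0) * (1 / real n)"
    by (intro tendsto_intros lim_1_over_n)
  then have lim: "(\<lambda>k. ?u k) \<longlonglongrightarrow> 1 / real n"
    by simp
  have "\<forall>\<^sub>F k in sequentially. 1 / real n \<le> (INF q \<in> difficulties n. ?r k q)"
    using bounds(1) by (rule eventually_sequentiallyI)
  moreover have "\<forall>\<^sub>F k in sequentially. (INF q \<in> difficulties n. ?r k q) \<le> ?u k"
    using bounds(2) by (rule eventually_sequentiallyI)
  ultimately show ?thesis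
    by (rule tendsto_sandwich[OF _ _ tendsto_const lim])
qed

theorem theorem7:
  fixes n \<tau> :: nat and \<pi> :: "nat \<Rightarrow> policy"
  assumes "n \<ge> 1" and "\<tau> \<ge> 1"
    and "\<And>C. C \<ge> 1 \<Longrightarrow> \<pi> C \<in> fair_policies n C"
  shows "(INF (L, C) \<in> demands n \<times> {1..}.
            real (eam_at n \<tau> (\<pi> C) L) / real (min (C * \<tau>) (\<Sum>i\<in>{1..n}. L i)))
          \<ge> real n powr (- 1 / real \<tau>)
    \<and> (\<forall>C\<ge>1. \<forall>q\<in>difficulties n. eam n 1 q (\<pi> C) / eam_opt n C 1 q \<ge> 1 / real n)
    \<and> (real n powr (1 / real \<tau>) \<in> real ` {1..} \<longrightarrow>
          (\<lambda>k. INF L \<in> demands n.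
             real (eam_at n \<tau> (\<pi> (k * n)) L) / real (min (k * n * \<tau>) (\<Sum>i\<in>{1..n}. L i)))
          \<longlonglongrightarrow> real n powr (- 1 / real \<tau>))
    \<and> (\<lambda>k. INF q \<in> difficulties n. eam n 1 q (\<pi> (k * n)) / eam_opt n (k * n) 1 q)
          \<longlonglongrightarrow> 1 / real n"
proof (intro conjI impI allI ballI)
  note n = \<open>n \<ge> 1\<close> and \<tau> = \<open>\<tau> \<ge> 1\<close> and \<pi> = assms(3)
  have "(\<lambda>i\<in>{1..n}. 1) \<in> demands n"
    by (auto simp: demands_def)
  \<comment> \<open>\<open>cINF_greatest\<close> needs a nonempty index set.\<close>
  then have "demands n \<times> {1::nat..} \<noteq> {}"
    by auto
  then show "real n powr (- 1 / real \<tau>) \<le> (INF (L, C) \<in> demands n \<times> {1..}.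
      real (eam_at n \<tau> (\<pi> C) L) / real (min (C * \<tau>) (\<Sum>i\<in>{1..n}. L i)))"
    using eam_at_ratio_ge[OF \<pi> _ n \<tau>] by (intro cINF_greatest) auto
  show "1 / real n \<le> eam n 1 q (\<pi> C) / eam_opt n C 1 q" if "1 \<le> C" for C q
    by (rule eam_one_round_ratio_ge[OF \<pi>[OF that] n that])
  show "(\<lambda>k. INF L \<in> demands n.
      real (eam_at n \<tau> (\<pi> (k * n)) L) / real (min (k * n * \<tau>) (\<Sum>i\<in>{1..n}. L i)))
      \<longlonglongrightarrow> real n powr (- 1 / real \<tau>)" if root: "real n powr (1 / real \<tau>) \<in> real ` {1..}"
  proof -
    obtain b :: nat where b: "1 \<le> b" "real n powr (1 / real \<tau>) = real b"
      using root by auto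
    \<comment> \<open>Raising the root to the power \<open>\<tau>\<close> recovers
      \<open>n = b ^ \<tau>\<close>, the form on which the worst case is built.\<close>
    have "real b ^ \<tau> = real n"
      using n \<tau> b by (simp add: powr_powr flip: b(2) powr_realpow)
    then have "n = b ^ \<tau>"
      by (metis of_nat_eq_iff of_nat_power)
    moreover have "real n powr (- 1 / real \<tau>) = 1 / real b"
      using b(2) by (simp add: powr_minus_divide)
    ultimately show ?thesis
      using tendsto_INF_eam_at_ratio[OF b(1) \<tau> _ \<pi>] by simp
  qed
  show "(\<lambda>k. INF q \<in> difficulties n. eam n 1 q (\<pi> (k * n)) / eam_opt n (k * n) 1 q) \<longlonglongrightarrow> 1 / real n"
    by (rule tendsto_INF_eam_one_round_ratio[OF n \<pi>])
qed

end
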